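(* Let $n\ge 1$ and let $$T_n=-\sum_{i=1}^n\mathbf{e}_i+(n+1)\,\mathrm{conv}\{\mathbf{0},\mathbf{e}_1,\dots,\mathbf{e}_n\}\subset\mathbb{R}^n .$$ Then for $i=1,\dots,n$ $$\rho_i(T_n,\mathbb{Z}^n)=\frac{1}{\left\lfloor\frac{n}{i+1}\right\rfloor+1}.$$
   Context: $\mathbf{e}_i$ denotes the $i$-th standard unit vector of $\mathbb{R}^n$ and $\mathrm{conv}$ the convex hull. Packing minima: for a convex body (compact convex set with non-empty interior) $K\subset\mathbb{R}^n$ with $\mathbf{0}\in\mathrm{int}(K)$, an $n$-dimensional lattice $\Lambda\subset\mathbb{R}^n$ and $1\le i\le n$, $$\rho_i(K,\Lambda)=\inf\{\rho>0:(\rho K+L)\cap\Lambda\ne L\cap\Lambda\ \text{ for all } L\in\mathcal{G}(\mathbb{R}^n,n-i)\},$$ where $\mathcal{G}(\mathbb{R}^n,k)$ is the set of all $k$-dimensional linear subspaces of $\mathbb{R}^n$. *)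

theory Defs
  imports "HOL-Analysis.Analysis"
begin

text \<open>
  The dimension \<open>n\<close> is \<open>CARD('n)\<close>, and \<open>+\<close> on sets is the Minkowski sum of
  \<open>HOL-Library.Set_Algebras\<close>.
\<close>

definition grassmannian :: "nat \<Rightarrow> (real ^ 'n) set set" where
  "grassmannian k = {L. subspace L \<and> dim L = k}"

text \<open>
  Only meaningful for a convex body \<open>K\<close> with \<open>0 \<in> interior K\<close>, a full-dimensional lattice \<open>\<Lambda>\<close>
  and \<open>1 \<le> i \<le> CARD('n)\<close>; for larger \<open>i\<close> the subtraction on \<^typ>\<open>nat\<close> truncates.
\<close>

definition packing_minimum :: "nat \<Rightarrow> (real ^ 'n) set \<Rightarrow> (real ^ 'n) set \<Rightarrow> real" where
  "packing_minimum i K \<Lambda> =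
     Inf {\<rho>. \<rho> > 0 \<and>
       (\<forall>L \<in> grassmannian (CARD('n) - i). ((*\<^sub>R) \<rho> ` K + L) \<inter> \<Lambda> \<noteq> L \<inter> \<Lambda>)}"

definition integer_lattice :: "(real ^ 'n) set" where
  "integer_lattice = {x. \<forall>j. x $ j \<in> \<int>}"

definition T_simplex :: "(real ^ 'n) set" where
  "T_simplex = (\<lambda>x. - (\<Sum>j\<in>UNIV. axis j 1) + (real CARD('n) + 1) *\<^sub>R x) `
     (convex hull insert 0 (range (\<lambda>j. axis j 1)))"

end

theory Submission
  imports Defs
begin

text \<open>
  Put \<open>m = n div (i + 1) + 1\<close>. In the barycentric coordinates \<open>x\<^sub>0 = - \<Sum>x\<^sub>j, x\<^sub>1, \<dots>, x\<^sub>n\<close> the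
  simplex \<open>T\<^sub>n\<close> is given by \<open>x\<^sub>j \<ge> -1\<close>. For the lower bound, split the \<open>n + 1\<close> indices into \<open>i + 1\<close>
  classes of size at most \<open>m\<close> and let \<open>L\<close> consist of the vectors whose sum over each class vanishes:
  if \<open>\<rho> < 1 / m\<close>, a lattice point in \<open>\<rho> T\<^sub>n + L\<close> has integral class sums that exceed \<open>-1\<close> and add
  up to zero, so it lies in \<open>L\<close>. For the upper bound, the \<open>n + 1\<close> vertices of the standard simplex
  project modulo \<open>L\<close> to points \<open>v\<^sub>j\<close> of an \<open>i\<close>-dimensional space, and Tverberg's theorem partitions
  them into \<open>m\<close> parts with a common point \<open>p\<close> in their convex hulls. If \<open>v\<^sub>b\<close> has the largest weight
  among all these representations of \<open>p\<close>, then \<open>\<Sum>v\<^sub>j - m v\<^sub>b\<close> is a nonnegative combination of the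
  \<open>v\<^sub>j\<close>, which says that \<open>e\<^sub>a - e\<^sub>b \<in> (1 / m) T\<^sub>n + L\<close> for every \<open>a\<close>.
\<close>

section \<open>Convex hulls of finite families and the colourful Caratheodory theorem\<close>

lemma convex_hull_range_finite:
  fixes s :: "'j::finite \<Rightarrow> 'a::real_vector"
  assumes "x \<in> convex hull range s"
  obtains u where "\<And>j. 0 \<le> u j" "sum u UNIV = 1" "(\<Sum>j\<in>UNIV. u j *\<^sub>R s j) = x"
proof -
  let ?H = "{x. \<exists>u. (\<forall>j. 0 \<le> u j) \<and> sum u UNIV = (1::real) \<and> (\<Sum>j\<in>UNIV. u j *\<^sub>R s j) = x}"
  have "s j \<in> ?H" for j
    by (rule CollectI, rule exI[of _ "\<lambda>k. if k = j then 1 else 0"])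
       (simp add: if_distrib[of "\<lambda>t. t *\<^sub>R _"] cong: if_cong)
  moreover have "convex ?H"
    unfolding convex_def
  proof clarify
    fix p q :: real and u w :: "'j \<Rightarrow> real"
    assume "0 \<le> p" "0 \<le> q" "p + q = 1" "\<forall>j. 0 \<le> u j" "sum u UNIV = 1" "\<forall>j. 0 \<le> w j" "sum w UNIV = 1"
    then show "\<exists>y. (\<forall>j. 0 \<le> y j) \<and> sum y UNIV = 1 \<and>
        (\<Sum>j\<in>UNIV. y j *\<^sub>R s j) = p *\<^sub>R (\<Sum>j\<in>UNIV. u j *\<^sub>R s j) + q *\<^sub>R (\<Sum>j\<in>UNIV. w j *\<^sub>R s j)"
      by (intro exI[of _ "\<lambda>j. p * u j + q * w j"])
         (simp add: sum.distrib scaleR_add_left scaleR_sum_right flip: sum_distrib_left)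
  qed
  ultimately have "convex hull range s \<subseteq> ?H"
    by (intro hull_minimal) auto
  with assms that show thesis by blast
qed

text \<open>Barany's argument: take the transversal whose hull comes closest to the origin. If its
  nearest point \<open>y\<close> is nonzero, \<open>y\<close> needs so few of the chosen points that
  some colour is free, and exchanging the point of that colour brings the hull closer.\<close>

theorem colorful_caratheodory:
  fixes S :: "'j::finite \<Rightarrow> 'a::euclidean_space set"
  assumes fin: "\<And>j. finite (S j)" and zero: "\<And>j. 0 \<in> convex hull S j"
    and sub: "\<And>j. S j \<subseteq> U" and dim: "dim U < CARD('j)"
  obtains s where "\<And>j. s j \<in> S j" "0 \<in> convex hull range s"
proof -
  let ?A = "{s. \<forall>j. s j \<in> S j}"
  let ?y = "\<lambda>s::'j \<Rightarrow> 'a. closest_point (convex hull range s) 0"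
  have "finite ?A"
    using finite_PiE[of UNIV S] fin by (simp add: PiE_def Pi_def)
  moreover have "S j \<noteq> {}" for j using zero[of j] by auto
  then have "?A \<noteq> {}"
    by (auto simp: ex_in_conv[symmetric] intro: choice)
  ultimately obtain s where sA: "s \<in> ?A" and smin: "\<And>s'. s' \<in> ?A \<Longrightarrow> norm (?y s) \<le> norm (?y s')"
    using ex_is_arg_min_if_finite[of ?A "\<lambda>s. norm (?y s)"]
    by (auto simp: is_arg_min_linorder)
  define y where "y = ?y s"
  have hull: "closed (convex hull range s')" "convex (convex hull range s')"
      "convex hull range s' \<noteq> {}" "compact (range s')" for s' :: "'j \<Rightarrow> 'a"
    by (auto simp: finite_imp_compact compact_imp_closed finite_imp_compact_convex_hull)
  have y_in: "y \<in> convex hull range s"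
    unfolding y_def by (intro closest_point_in_set hull)
  have "y = 0"
  proof (rule ccontr)
    assume "y \<noteq> 0"
    have supp: "y \<bullet> x \<ge> y \<bullet> y" if "x \<in> convex hull range s" for x
      using closest_point_dot[OF hull(2,1) that, of 0] by (simp add: y_def inner_diff_right)
    have face: "(convex hull range s) \<inter> {x. y \<bullet> x = y \<bullet> y} face_of convex hull range s"
      by (intro face_of_Int_supporting_hyperplane_ge) (use supp hull in auto)
    obtain F where F: "F \<subseteq> range s" "(convex hull range s) \<inter> {x. y \<bullet> x = y \<bullet> y} = convex hull F"
      using face_of_convex_hull_subset[OF hull(4) face] by blast
    have Fh: "F \<subseteq> {x. y \<bullet> x = y \<bullet> y}" using F(2) hull_subset[of F convex] by blast
    have "affine hull F \<subseteq> {x. y \<bullet> x = y \<bullet> y}"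
      by (intro hull_minimal Fh affine_hyperplane)
    then have "0 \<notin> affine hull F" using \<open>y \<noteq> 0\<close> by auto
    \<comment> \<open>\<open>F\<close> lies in a hyperplane missing the origin, so adjoining
      \<open>0\<close> raises the affine dimension. This saves one point over plain Caratheodory:
      \<open>dim U\<close> points suffice for \<open>y\<close>, fewer than there are
      colours.\<close>
    then have "aff_dim F + 1 = aff_dim (insert 0 F)"
      by (simp add: aff_dim_insert)
    also have "\<dots> = int (dim (insert 0 F))"
      by (rule aff_dim_zero) (simp add: hull_inc)
    also have "dim (insert 0 F) = dim F"
      by (simp add: dim_insert span_zero)
    also have "int (dim F) \<le> int (dim U)"
    proof -
      have "s j \<in> U" for j using sA sub[of j] by auto
      then have "F \<subseteq> U" using F(1) by auto
      then show ?thesis by (simp add: dim_subset)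
    qed
    finally have aff: "aff_dim F + 1 \<le> int (dim U)" .
    have "y \<in> convex hull F" using F(2) y_in by blast
    then obtain G where G: "G \<subseteq> F" "int (card G) \<le> aff_dim F + 1" "y \<in> convex hull G"
      by (subst (asm) caratheodory_aff_dim) auto
    obtain J where J: "inj_on s J" "G = s ` J"
      using G(1) F(1) subset_image_inj[of G s UNIV] by auto
    have "card J < CARD('j)"
      using G(2) J aff dim by (simp add: card_image)
    then obtain j where j: "j \<notin> J" by (metis UNIV_eq_I less_irrefl)
    \<comment> \<open>Otherwise the whole colour class, and with it the origin in its hull, would
      lie in an open halfspace.\<close>
    obtain x where x: "x \<in> S j" "y \<bullet> x \<le> 0"
    proof (rule ccontr)
      assume "\<not> thesis"
      then have "S j \<subseteq> {x. y \<bullet> x > 0}" using that by force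
      then have "convex hull S j \<subseteq> {x. y \<bullet> x > 0}"
        by (intro hull_minimal convex_halfspace_gt)
      then show False using zero[of j] by auto
    qed
    let ?s = "s(j := x)"
    have "?s \<in> ?A" using sA x by auto
    have "G \<subseteq> range ?s" using J j by auto
    then have y': "y \<in> convex hull range ?s" using G(3) hull_mono by blast
    \<comment> \<open>The exchange keeps \<open>G\<close>, hence \<open>y\<close>, in the hull, so
      minimality makes \<open>y\<close> the nearest point of the new hull as well. The obtuse angle
      criterion at \<open>x\<close> then contradicts the choice of \<open>x\<close>.\<close>
    have "norm y \<le> norm z" if "z \<in> convex hull range ?s" for z
      using smin[OF \<open>?s \<in> ?A\<close>] closest_point_le[OF hull(1) that, of 0]
      by (simp add: y_def)
    moreover have "x \<in> convex hull range ?s"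
      by (intro hull_inc) (metis fun_upd_same rangeI)
    ultimately have "(0 - y) \<bullet> (x - y) \<le> 0"
      by (intro any_closest_point_dot[OF hull(2,1) y']) auto
    then have "y \<bullet> y \<le> 0" using x(2) by (simp add: inner_diff_right)
    then show False using \<open>y \<noteq> 0\<close> inner_gt_zero_iff[of y] by linarith
  qed
  with y_in sA that show thesis by auto
qed

section \<open>Tverberg partitions and the heaviest vector\<close>

text \<open>Sarkaria's tensor trick: the vectors \<open>v\<^sub>j \<otimes> q\<^sub>c\<close>, where the \<open>q\<^sub>c\<close> are the unit vectors
  together with minus their sum (colour \<^const>\<open>None\<close>), satisfy the colourful Caratheodory theorem.\<close>

theorem tverberg_cone:
  fixes v :: "'j::finite \<Rightarrow> 'a::euclidean_space" and K :: "'k::finite set"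
  assumes card: "card K * dim (range v) < CARD('j)"
  obtains c :: "'j \<Rightarrow> 'k option" and w :: "'j \<Rightarrow> real" and p :: 'a
  where "range c \<subseteq> insert None (Some ` K)" "\<And>j. 0 \<le> w j" "sum w UNIV = 1"
    "\<And>d. d \<in> insert None (Some ` K) \<Longrightarrow> (\<Sum>j | c j = d. w j *\<^sub>R v j) = p"
proof -
  let ?C = "insert None (Some ` K)"
  define t :: "'a \<Rightarrow> 'k option \<Rightarrow> 'a ^ 'k"
    where "t x d = (case d of None \<Rightarrow> - (\<Sum>k\<in>K. axis k x) | Some k \<Rightarrow> axis k x)" for x d
  have t_sum: "sum (t x) ?C = 0" for x
    by (subst sum.insert) (auto simp: t_def sum.reindex)
  obtain B where B: "range v \<subseteq> span B" "card B = dim (range v)" "finite B"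
    using basis_exists[of "range v"] finiteI_independent by metis
  let ?B = "(\<lambda>(k, b). axis k b :: 'a ^ 'k) ` (K \<times> B)"
  have lin: "linear (axis k :: 'a \<Rightarrow> 'a ^ 'k)" for k
    by (rule linearI) (auto simp: axis_def vec_eq_iff)
  have axis_in: "axis k (v j) \<in> span ?B" if "k \<in> K" for k j
  proof -
    have "axis k (v j) \<in> axis k ` span B" using B(1) by auto
    also have "\<dots> = span (axis k ` B)" by (rule linear_span_image[OF lin, symmetric])
    also have "\<dots> \<subseteq> span ?B" using that by (intro span_mono) auto
    finally show ?thesis .
  qed
  have "dim (span ?B) \<le> card ?B" using B(3) by (simp add: dim_le_card')
  also have "\<dots> \<le> card K * card B"
    using card_image_le[of "K \<times> B" "\<lambda>(k, b). axis k b :: 'a ^ 'k"] B(3)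
    by (simp add: card_cartesian_product)
  finally have dim: "dim (span ?B) < CARD('j)" using card B(2) by simp
  have zero: "0 \<in> convex hull (t x ` ?C)" for x
  proof -
    have "(\<Sum>d\<in>?C. (1 / card ?C) *\<^sub>R t x d) \<in> convex hull (t x ` ?C)"
      by (intro convex_sum) (auto simp: hull_inc)
    then show ?thesis by (simp only: scaleR_sum_right[symmetric] t_sum) simp
  qed
  obtain s where s: "\<And>j. s j \<in> t (v j) ` ?C" "0 \<in> convex hull range s"
  proof (rule colorful_caratheodory[of "\<lambda>j. t (v j) ` ?C" "span ?B"])
    show "t (v j) ` ?C \<subseteq> span ?B" for j
      by (auto simp: t_def axis_in intro!: span_neg span_sum)
  qed (use zero dim in auto)
  have "\<forall>j. \<exists>d. d \<in> ?C \<and> s j = t (v j) d" using s(1) by blast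
  then obtain c where c: "\<And>j. c j \<in> ?C" "\<And>j. s j = t (v j) (c j)" by metis
  obtain w where w: "\<And>j. 0 \<le> w j" "sum w UNIV = 1" "(\<Sum>j\<in>UNIV. w j *\<^sub>R s j) = 0"
    using convex_hull_range_finite[OF s(2)] by metis
  have "(\<Sum>j | c j = Some k. w j *\<^sub>R v j) = (\<Sum>j | c j = None. w j *\<^sub>R v j)" if "k \<in> K" for k
  proof -
    \<comment> \<open>The block \<open>k\<close> receives colour \<open>Some k\<close> with a plus
      sign and colour \<open>None\<close> with a minus sign, so the vanishing of the combination
      equates these two class sums.\<close>
    have comp: "w j *\<^sub>R (s j $ k) = (if c j = Some k then w j *\<^sub>R v j else 0)
        - (if c j = None then w j *\<^sub>R v j else 0)" for j
      using that by (cases "c j") (auto simp: c(2) t_def axis_def)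
    have "0 = (\<Sum>j\<in>UNIV. w j *\<^sub>R s j) $ k" by (simp add: w(3))
    also have "\<dots> = (\<Sum>j\<in>UNIV. w j *\<^sub>R (s j $ k))" by simp
    also have "\<dots> = (\<Sum>j | c j = Some k. w j *\<^sub>R v j) - (\<Sum>j | c j = None. w j *\<^sub>R v j)"
      unfolding comp sum_subtractf by (simp add: sum.If_cases)
    finally show ?thesis by simp
  qed
  then have "(\<Sum>j | c j = d. w j *\<^sub>R v j) = (\<Sum>j | c j = None. w j *\<^sub>R v j)" if "d \<in> ?C" for d
    using that by (elim insertE imageE) simp_all
  moreover have "range c \<subseteq> ?C" using c(1) by (intro image_subsetI)
  ultimately show thesis by (intro that[of c w] w(1,2))
qed

text \<open>The vector carrying the largest weight of a Tverberg partition is the one that can be split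
  off \<open>r + 1\<close> times.\<close>

lemma sum_minus_multiple_in_cone:
  fixes v :: "'j::finite \<Rightarrow> 'a::euclidean_space"
  assumes card: "r * dim (range v) < CARD('j)"
  obtains b \<mu> where "\<And>j. 0 \<le> \<mu> j"
    "(\<Sum>j\<in>UNIV. v j) = (real r + 1) *\<^sub>R v b + (\<Sum>j\<in>UNIV. \<mu> j *\<^sub>R v j)"
\<comment> \<open>In dimension zero the hypothesis does not bound \<open>r\<close>. Otherwise
  \<open>r\<close> is at most the size of \<open>'j\<close>, so the colours can be taken from
  \<open>'j\<close> itself.\<close>
proof (cases "dim (range v) = 0")
  case True
  then have "v j = 0" for j by (auto simp: dim_eq_0)
  then show thesis using that[of "\<lambda>_. 0"] by simp
next
  case False
  then have "r \<le> CARD('j)" using card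
    by (metis Suc_leI le_trans less_imp_le mult_le_mono2 mult.right_neutral neq0_conv One_nat_def)
  then obtain K :: "'j set" where K: "card K = r"
    using obtain_subset_with_card_n by blast
  let ?C = "insert None (Some ` K)"
  obtain c :: "'j \<Rightarrow> 'j option" and w p
    where c: "range c \<subseteq> ?C" and w: "\<And>j. 0 \<le> w j" "sum w UNIV = 1"
      and p: "\<And>d. d \<in> ?C \<Longrightarrow> (\<Sum>j | c j = d. w j *\<^sub>R v j) = p"
    using tverberg_cone[of K v] card K by metis
  obtain b where b: "\<And>j. w j \<le> w b"
    using Max_in[of "range w"] Max_ge[of "range w"]
    by (metis finite_imageI finite_class.finite_UNIV empty_is_image UNIV_not_empty imageE rangeI)
  have M: "w b > 0"
  proof (rule ccontr)
    assume "\<not> w b > 0"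
    then have "w j = 0" for j using b[of j] w(1)[of j] by linarith
    then show False using w(2) by simp
  qed
  \<comment> \<open>To the sum of all \<open>v j\<close>, add \<open>r / w b\<close> times the class
    sum of \<open>b\<close> and subtract \<open>1 / w b\<close> times the \<open>r\<close> other
    class sums; these changes cancel, since all class sums equal \<open>p\<close>. The coefficient
    of \<open>v b\<close> becomes \<open>r + 1\<close>, and outside the class of \<open>b\<close>
    maximality of \<open>w b\<close> keeps coefficients nonnegative.\<close>
  define \<mu> where "\<mu> j = 1 + (real r * (if c j = c b then w j else 0) - (if c j \<noteq> c b then w j else 0)) / w b
      - (if j = b then real r + 1 else 0)" for j
  have "0 \<le> \<mu> j" for j
    using b[of j] M w(1)[of j] by (auto simp: \<mu>_def field_simps)
  moreover have "(\<Sum>j\<in>UNIV. \<mu> j *\<^sub>R v j) = (\<Sum>j\<in>UNIV. v j) - (real r + 1) *\<^sub>R v b"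
  proof -
    have same: "(\<Sum>j | c j = c b. w j *\<^sub>R v j) = p" using p c by auto
    have "(\<Sum>j | c j \<noteq> c b. w j *\<^sub>R v j) = (\<Sum>d\<in>?C - {c b}. \<Sum>j | j \<in> {j. c j \<noteq> c b} \<and> c j = d. w j *\<^sub>R v j)"
      by (rule sum.group[symmetric]) (use c in auto)
    also have "\<dots> = (\<Sum>d\<in>?C - {c b}. p)"
    proof (rule sum.cong[OF refl])
      fix d assume "d \<in> ?C - {c b}"
      then have "{j. j \<in> {j. c j \<noteq> c b} \<and> c j = d} = {j. c j = d}" "d \<in> ?C" by auto
      then show "(\<Sum>j | j \<in> {j. c j \<noteq> c b} \<and> c j = d. w j *\<^sub>R v j) = p" using p by simp
    qed
    also have "\<dots> = real r *\<^sub>R p"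
    proof -
      have "card (?C - {c b}) = r"
        using c K by (subst card_Diff_singleton) (auto simp: card_image)
      then show ?thesis by (simp add: sum_constant_scaleR)
    qed
    finally have other: "(\<Sum>j | c j \<noteq> c b. w j *\<^sub>R v j) = real r *\<^sub>R p" .
    have "\<mu> j *\<^sub>R v j = v j + (real r / w b) *\<^sub>R (if c j = c b then w j *\<^sub>R v j else 0)
        - (1 / w b) *\<^sub>R (if c j \<noteq> c b then w j *\<^sub>R v j else 0)
        - (if j = b then (real r + 1) *\<^sub>R v j else 0)" for j
      by (auto simp: \<mu>_def algebra_simps diff_divide_distrib)
    then have "(\<Sum>j\<in>UNIV. \<mu> j *\<^sub>R v j) = (\<Sum>j\<in>UNIV. v j)
        + (real r / w b) *\<^sub>R (\<Sum>j | c j = c b. w j *\<^sub>R v j)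
        - (1 / w b) *\<^sub>R (\<Sum>j | c j \<noteq> c b. w j *\<^sub>R v j) - (real r + 1) *\<^sub>R v b"
      by (simp add: sum.distrib sum_subtractf scaleR_sum_right[symmetric] sum.inter_filter[symmetric])
    then show ?thesis by (simp add: same other)
  qed
  ultimately show thesis using that[of \<mu> b] by simp
qed

section \<open>Barycentric inequalities of the simplex and quotients by subspaces\<close>

lemma T_simplex_eq:
  "(T_simplex :: (real ^ 'n::finite) set) = {x. (\<forall>j. -1 \<le> x $ j) \<and> (\<Sum>j\<in>UNIV. x $ j) \<le> 1}"
proof -
  have B: "range (\<lambda>j::'n. axis j (1::real)) = Basis"
    by (auto simp: Basis_vec_def)
  have hull: "convex hull insert 0 (range (\<lambda>j::'n. axis j (1::real)))
      = {x. (\<forall>j. 0 \<le> x $ j) \<and> (\<Sum>j\<in>UNIV. x $ j) \<le> 1}"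
    unfolding B std_simplex
    by (auto simp: B[symmetric] sum.reindex inj_on_def axis_eq_axis inner_axis)
  have one: "(\<Sum>j\<in>UNIV. axis j 1) $ k = (1::real)" for k :: 'n
    by (simp add: axis_def)
  let ?N = "real CARD('n) + 1"
  show ?thesis
  proof (intro set_eqI iffI)
    fix x :: "real ^ 'n" assume "x \<in> T_simplex"
    then obtain y where y: "\<And>j. 0 \<le> y $ j" "(\<Sum>j\<in>UNIV. y $ j) \<le> 1"
        and x: "x = - (\<Sum>j\<in>UNIV. axis j 1) + ?N *\<^sub>R y"
      unfolding T_simplex_def hull by auto
    have xj: "x $ j = -1 + ?N * y $ j" for j
      using one[of j] by (simp add: x del: sum_component)
    have "(\<Sum>j\<in>UNIV. x $ j) = ?N * (\<Sum>j\<in>UNIV. y $ j) - CARD('n)"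
      unfolding xj by (simp only: sum.distrib sum_distrib_left[symmetric]) simp
    moreover have "?N * (\<Sum>j\<in>UNIV. y $ j) \<le> ?N * 1"
      using y(2) by (intro mult_left_mono) auto
    ultimately have "(\<Sum>j\<in>UNIV. x $ j) \<le> 1" by (simp add: algebra_simps)
    moreover have "-1 \<le> x $ j" for j using y(1) by (simp add: xj)
    ultimately show "x \<in> {x. (\<forall>j. -1 \<le> x $ j) \<and> (\<Sum>j\<in>UNIV. x $ j) \<le> 1}" by simp
  next
    fix x :: "real ^ 'n" assume "x \<in> {x. (\<forall>j. -1 \<le> x $ j) \<and> (\<Sum>j\<in>UNIV. x $ j) \<le> 1}"
    then have x: "\<And>j. -1 \<le> x $ j" "(\<Sum>j\<in>UNIV. x $ j) \<le> 1" by auto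
    let ?y = "\<chi> j. (x $ j + 1) / ?N"
    have pos: "0 \<le> x $ j + 1" for j using x(1)[of j] by linarith
    have "(\<Sum>j\<in>UNIV. ?y $ j) = ((\<Sum>j\<in>UNIV. x $ j) + CARD('n)) / ?N"
      by (simp add: sum_divide_distrib[symmetric] sum.distrib)
    then have "?y \<in> convex hull insert 0 (range (\<lambda>j::'n. axis j (1::real)))"
      unfolding hull using pos x(2) by simp
    moreover have "x = - (\<Sum>j\<in>UNIV. axis j 1) + ?N *\<^sub>R ?y"
      by (simp add: vec_eq_iff axis_def)
    ultimately show "x \<in> T_simplex" unfolding T_simplex_def by blast
  qed
qed

text \<open>A quotient map modulo \<open>L\<close>, realised inside the space from a basis
  \<open>B\<close> of the orthogonal complement. Pairing \<open>f x\<close> with \<open>x\<close>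
  gives the sum of the squares of the \<open>b \<bullet> x\<close>, so the kernel is the double
  complement of \<open>L\<close>.\<close>

lemma subspace_kernel_exists:
  fixes L :: "'a::euclidean_space set"
  assumes "subspace L"
  obtains f :: "'a \<Rightarrow> 'a" and B where "linear f" "\<And>x. f x = 0 \<longleftrightarrow> x \<in> L"
    "range f \<subseteq> span B" "finite B" "card B + dim L = DIM('a)"
proof -
  obtain B where B: "B \<subseteq> L\<^sup>\<bottom>" "independent B" "card B = dim (L\<^sup>\<bottom>)" "span B = L\<^sup>\<bottom>"
    using orthonormal_basis_subspace[OF subspace_orthogonal_comp[of L]] by metis
  have fin: "finite B" using B(2) by (rule finiteI_independent)
  let ?f = "\<lambda>x. \<Sum>b\<in>B. (b \<bullet> x) *\<^sub>R b"
  have "linear ?f"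
    by (rule linearI) (simp_all add: inner_add_right scaleR_add_left sum.distrib scaleR_sum_right)
  moreover have "?f x = 0 \<longleftrightarrow> x \<in> L" for x
  proof
    assume "?f x = 0"
    then have "(\<Sum>b\<in>B. (b \<bullet> x)\<^sup>2) = 0"
      using inner_sum_right[of x "\<lambda>b. (b \<bullet> x) *\<^sub>R b" B]
      by (simp add: power2_eq_square inner_commute)
    then have "orthogonal x b" if "b \<in> B" for b
      using that fin by (simp add: sum_nonneg_eq_0_iff orthogonal_def inner_commute)
    then have "orthogonal x y" if "y \<in> span B" for y
      using that orthogonal_to_span by blast
    then have "x \<in> L\<^sup>\<bottom>\<^sup>\<bottom>"
      unfolding B(4) by (auto simp: orthogonal_comp_def orthogonal_commute)
    then show "x \<in> L" by (simp add: orthogonal_comp_self assms)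
  next
    assume "x \<in> L"
    then have "b \<bullet> x = 0" if "b \<in> B" for b
      using B(1) that by (auto simp: orthogonal_comp_def orthogonal_def inner_commute)
    then show "?f x = 0" by simp
  qed
  moreover have "range ?f \<subseteq> span B"
    by (intro image_subsetI span_sum span_scale span_base)
  moreover have "card B + dim L = DIM('a)"
    using dim_subspace_orthogonal_to_vectors[OF assms subspace_UNIV] B(3)
    by (simp add: orthogonal_comp_def)
  ultimately show thesis using that fin by blast
qed

lemma sum_option_UNIV:
  "(\<Sum>j\<in>UNIV. g j) = g None + (\<Sum>j\<in>UNIV. g (Some j))"
  for g :: "'n::finite option \<Rightarrow> 'a::comm_monoid_add"
  unfolding UNIV_option_conv by (subst sum.insert) (auto simp: sum.reindex)

section \<open>The upper bound, for every subspace\<close>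

text \<open>\<^const>\<open>None\<close> plays the role of the vertex of the simplex that corresponds to the origin.\<close>

lemma lattice_point_outside_subspace:
  fixes L :: "(real ^ 'n::finite) set"
  assumes L: "L \<in> grassmannian (CARD('n) - i)" and i: "1 \<le> i" "i \<le> CARD('n)"
    and \<rho>: "\<rho> = 1 / (real (CARD('n) div (i + 1)) + 1)"
  shows "((*\<^sub>R) \<rho> ` T_simplex + L) \<inter> integer_lattice \<noteq> L \<inter> integer_lattice"
proof -
  let ?n = "CARD('n)"
  define r where "r = ?n div (i + 1)"
  define m where "m = real r + 1"
  have m: "m > 0" "\<rho> = 1 / m" by (auto simp: m_def r_def \<rho>)
  have subL: "subspace L" and dimL: "dim L = ?n - i" using L by (auto simp: grassmannian_def)
  obtain f :: "real ^ 'n \<Rightarrow> real ^ 'n" and B where f: "linear f" "\<And>x. f x = 0 \<longleftrightarrow> x \<in> L"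
    and B: "range f \<subseteq> span B" "finite B" "card B + dim L = ?n"
    using subspace_kernel_exists[OF subL] by auto
  have cardB: "card B = i" using B(3) dimL i by simp
  define e :: "'n option \<Rightarrow> real ^ 'n" where "e j = (case j of None \<Rightarrow> 0 | Some k \<Rightarrow> axis k 1)" for j
  \<comment> \<open>The constant coordinate \<open>1\<close> turns affine relations into linear ones
    and records the total weight. It costs one dimension, whence \<open>i + 1\<close> in the
    definition of \<open>r\<close>.\<close>
  define v :: "'n option \<Rightarrow> (real ^ 'n) \<times> real" where "v j = (f (e j), 1)" for j
  let ?W = "insert (0, 1) ((\<lambda>b. (b, 0::real)) ` B)"
  have "v j \<in> span ?W" for j
  proof -
    have lin: "linear (\<lambda>x::real ^ 'n. (x, 0::real))" by (rule linearI) auto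
    have "(f (e j), 0::real) \<in> (\<lambda>x. (x, 0::real)) ` span B" using B(1) by auto
    also have "\<dots> = span ((\<lambda>x. (x, 0::real)) ` B)" by (rule linear_span_image[OF lin, symmetric])
    also have "\<dots> \<subseteq> span ?W" by (intro span_mono) auto
    finally have "(f (e j), 0) + (0, 1) \<in> span ?W" by (rule span_add) (simp add: span_base)
    then show ?thesis by (simp add: v_def)
  qed
  then have "dim (range v) \<le> card ?W" using B(2) by (intro dim_le_card) auto
  also have "\<dots> \<le> i + 1"
    using card_image_le[OF B(2), of "\<lambda>b. (b, 0::real)"] B(2) cardB
    by (simp add: card_insert_if)
  finally have "r * dim (range v) \<le> r * (i + 1)" by (rule mult_le_mono2)
  also have "\<dots> \<le> ?n" by (simp add: r_def div_times_less_eq_dividend del: add_Suc_right)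
  finally have "r * dim (range v) < CARD('n option)" by (simp add: card_UNIV_option)
  then obtain b \<mu> where \<mu>: "\<And>j. 0 \<le> \<mu> j"
      and v: "(\<Sum>j\<in>UNIV. v j) = m *\<^sub>R v b + (\<Sum>j\<in>UNIV. \<mu> j *\<^sub>R v j)"
    using sum_minus_multiple_in_cone[of r v] unfolding m_def by metis
  have mass: "real ?n + 1 = m + (\<Sum>j\<in>UNIV. \<mu> j)"
    using arg_cong[OF v, of snd] by (simp add: snd_sum v_def card_UNIV_option)
  have fe: "(\<Sum>j\<in>UNIV. f (e j)) = m *\<^sub>R f (e b) + (\<Sum>j\<in>UNIV. \<mu> j *\<^sub>R f (e j))"
    using arg_cong[OF v, of fst] by (simp add: fst_sum v_def)
  obtain a where a: "f (e a) \<noteq> f (e b)"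
  proof (rule ccontr)
    assume "\<not> thesis"
    then have "f (e j) = f (e None)" for j using that by metis
    then have ax: "f (axis k 1) = 0" for k
      using f(1) by (metis e_def option.simps(4,5) linear_0)
    have "Basis \<subseteq> L" using ax f(2) by (auto simp: Basis_vec_def)
    then have "L = UNIV"
      using span_Basis span_minimal[OF _ subL] by blast
    then show False using dimL i by simp
  qed
  have f_expand: "f x = (\<Sum>j\<in>UNIV. x $ j *\<^sub>R f (axis j 1))" for x
  proof -
    have "f x = f (\<Sum>j\<in>UNIV. x $ j *\<^sub>R axis j 1)" by (simp add: basis_expansion flip: scalar_mult_eq_scaleR)
    then show ?thesis by (simp add: linear_sum[OF f(1)] linear_scale[OF f(1)])
  qed
  define z where "z = e a - e b"
  \<comment> \<open>Barycentric coordinates of the point \<open>x\<close> congruent to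
    \<open>z\<close> modulo \<open>L\<close>: \<open>\<mu> \<ge> 0\<close> gives the bound
    \<open>-1 / m\<close>, \<open>mass\<close> gives sum zero, and \<open>fe\<close> turns
    \<open>m *\<^sub>R f x\<close> into \<open>m *\<^sub>R (f (e a) - f (e b))\<close>.\<close>
  define g where "g j = (\<mu> j + (if j = a then m else 0) - 1) / m" for j
  define x :: "real ^ 'n" where "x = (\<chi> j. g (Some j))"
  have "z \<in> integer_lattice"
    by (auto simp: z_def e_def integer_lattice_def axis_def split: option.split)
  moreover have fz: "f z = f (e a) - f (e b)" by (simp add: z_def linear_diff[OF f(1)])
  then have "z \<notin> L" using a f(2)[of z] by simp
  moreover have "z \<in> (*\<^sub>R) \<rho> ` T_simplex + L"
  proof -
    have ge: "-1 / m \<le> g j" for j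
      using \<mu>[of j] m unfolding g_def by (intro divide_right_mono) auto
    have "(\<Sum>j\<in>UNIV. g j) = ((\<Sum>j\<in>UNIV. \<mu> j) + m - (real ?n + 1)) / m"
      by (simp add: g_def sum_divide_distrib[symmetric] sum.distrib sum_subtractf card_UNIV_option)
    then have "(\<Sum>j\<in>UNIV. g j) = 0" using mass by simp
    then have "(\<Sum>j\<in>UNIV. x $ j) \<le> 1 / m"
      using ge[of None] by (simp add: sum_option_UNIV x_def)
    then have "m *\<^sub>R x \<in> T_simplex"
      using ge m by (auto simp: T_simplex_eq x_def field_simps sum_distrib_left[symmetric])
    then have xT: "x \<in> (*\<^sub>R) \<rho> ` T_simplex"
      using m by (intro image_eqI[of _ _ "m *\<^sub>R x"]) auto
    have "f x = (\<Sum>j\<in>UNIV. g j *\<^sub>R f (e j))"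
      by (subst f_expand) (simp add: sum_option_UNIV x_def e_def linear_0[OF f(1)])
    then have "m *\<^sub>R f x = (\<Sum>j\<in>UNIV. (m * g j) *\<^sub>R f (e j))"
      by (simp add: scaleR_sum_right)
    also have "\<dots> = (\<Sum>j\<in>UNIV. \<mu> j *\<^sub>R f (e j) + (if j = a then m *\<^sub>R f (e j) else 0) - f (e j))"
    proof (intro sum.cong refl)
      fix j
      have "m * g j = \<mu> j + (if j = a then m else 0) - 1" using m by (simp add: g_def)
      then show "(m * g j) *\<^sub>R f (e j)
          = \<mu> j *\<^sub>R f (e j) + (if j = a then m *\<^sub>R f (e j) else 0) - f (e j)"
        by (simp add: scaleR_add_left scaleR_diff_left)
    qed
    also have "\<dots> = m *\<^sub>R f z"
      by (simp add: sum.distrib sum_subtractf fe fz algebra_simps)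
    finally have "f (z - x) = 0" using m by (simp add: linear_diff[OF f(1)])
    then have "x + (z - x) \<in> (*\<^sub>R) \<rho> ` T_simplex + L"
      using xT f(2) by (intro set_plus_intro) auto
    then show ?thesis by simp
  qed
  ultimately show ?thesis by blast
qed

section \<open>The lower bound, from residue classes of coordinates\<close>

text \<open>The quotient by \<open>k\<close> determines an element of a residue class.\<close>

lemma card_residue_class_le:
  "card {t \<in> {..n}. t mod k = s} \<le> n div k + 1" for n k s :: nat
proof -
  have "inj_on (\<lambda>t. t div k) {t \<in> {..n}. t mod k = s}"
    by (rule inj_onI) (metis (mono_tags, lifting) div_mult_mod_eq mem_Collect_eq)
  moreover have "(\<lambda>t. t div k) ` {t \<in> {..n}. t mod k = s} \<subseteq> {..n div k}"
    by (auto simp: div_le_mono)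
  ultimately have "card {t \<in> {..n}. t mod k = s} \<le> card {..n div k}"
    by (metis card_image card_mono finite_atMost)
  then show ?thesis by simp
qed

text \<open>The \<open>n + 1\<close> barycentric indices are split into residue classes modulo \<open>i + 1\<close>, the index \<open>n\<close>
  belonging to the coordinate \<open>- \<Sum>x\<^sub>j\<close>; the subspace consists of the vectors whose coordinates
  sum to zero over every class.\<close>

lemma subspace_without_new_lattice_points:
  assumes i: "1 \<le> i" "i \<le> CARD('n::finite)"
    and \<rho>: "0 < \<rho>" "\<rho> < 1 / (real (CARD('n) div (i + 1)) + 1)"
  obtains L :: "(real ^ 'n) set" where "L \<in> grassmannian (CARD('n) - i)"
    "((*\<^sub>R) \<rho> ` T_simplex + L) \<inter> integer_lattice = L \<inter> integer_lattice"
proof -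
  let ?n = "CARD('n)"
  define m where "m = real (?n div (i + 1)) + 1"
  have \<rho>m: "\<rho> * m < 1" using \<rho> by (simp add: m_def field_simps)
  obtain \<beta> :: "'n \<Rightarrow> nat" where \<beta>: "bij_betw \<beta> UNIV {..<?n}"
    using ex_bij_betw_finite_nat[of "UNIV :: 'n set"] by (auto simp: atLeast0LessThan)
  define P where "P k = {j. \<beta> j mod (i + 1) = k}" for k
  \<comment> \<open>The class of the extra index \<open>n\<close>. Its sum is determined by the
    others because all barycentric coordinates add up to zero, so the \<open>i\<close> classes in
    \<open>R\<close> define \<open>L\<close>.\<close>
  define q where "q = ?n mod (i + 1)"
  define R where "R = {..i} - {q}"
  have q: "q \<le> i" by (simp add: q_def less_Suc_eq_le[symmetric])
  have cardR: "card R = i" using q by (simp add: R_def)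
  have img: "\<beta> ` P k = {t \<in> {..<?n}. t mod (i + 1) = k}" for k
    unfolding P_def bij_betw_imp_surj_on[OF \<beta>, symmetric] by auto
  have cardP: "card (P k) = card {t \<in> {..<?n}. t mod (i + 1) = k}" for k
    unfolding img[symmetric] using \<beta>
    by (metis bij_betw_def card_image inj_on_subset subset_UNIV)
  have P_le: "real (card (P k)) \<le> m" for k
  proof -
    have "card {t \<in> {..<?n}. t mod (i + 1) = k} \<le> card {t \<in> {..?n}. t mod (i + 1) = k}"
      by (rule card_mono) auto
    then show ?thesis
      using card_residue_class_le[of ?n "i + 1" k] by (simp add: m_def cardP)
  qed
  have Pq_le: "real (card (P q)) + 1 \<le> m"
  proof -
    have "{t \<in> {..?n}. t mod (i + 1) = q} = insert ?n {t \<in> {..<?n}. t mod (i + 1) = q}"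
      by (auto simp: q_def)
    then show ?thesis
      using card_residue_class_le[of ?n "i + 1" q] by (simp add: m_def cardP)
  qed
  have P_ne: "P k \<noteq> {}" if "k \<in> R" for k
  proof -
    have "k \<le> i" "k \<noteq> q" using that by (auto simp: R_def)
    \<comment> \<open>If \<open>i = n\<close>, all classes are singletons and the only
      \<open>k\<close> to exclude is \<open>n\<close>, which is \<open>q\<close>.\<close>
    then have "k < ?n" using i by (cases "i = ?n") (auto simp: q_def)
    then have "k \<in> \<beta> ` P k" unfolding img using \<open>k \<le> i\<close> by simp
    then show ?thesis by auto
  qed
  define u :: "nat \<Rightarrow> real ^ 'n" where "u k = (\<chi> j. if j \<in> P k then 1 else 0)" for k
  have inner: "u k \<bullet> x = (\<Sum>j\<in>P k. x $ j)" for k x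
    by (simp add: inner_vec_def u_def if_distrib[of "\<lambda>t. t * _"] sum.If_cases cong: if_cong)
  have ortho: "u k \<bullet> u l = 0" if "k \<noteq> l" for k l
    using that by (simp add: inner) (auto simp: u_def P_def)
  have nz: "u k \<bullet> u k \<noteq> 0" if "k \<in> R" for k
    using P_ne[OF that] by (simp add: inner) (auto simp: u_def)
  have inj: "inj_on u R" by (rule inj_onI) (metis ortho nz)
  have "independent (u ` R)"
  proof (rule pairwise_orthogonal_independent)
    show "pairwise orthogonal (u ` R)"
      by (auto simp: pairwise_def orthogonal_def) (metis ortho)
    show "0 \<notin> u ` R" using nz by force
  qed
  then have dimu: "dim (span (u ` R)) = i"
    by (simp add: dim_eq_card_independent card_image inj cardR)
  define L where "L = {y. \<forall>k\<in>R. u k \<bullet> y = 0}"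
  have L_eq: "L = {y \<in> UNIV. \<forall>x \<in> span (u ` R). orthogonal x y}"
    unfolding L_def
    by (auto simp: orthogonal_def[symmetric] span_base orthogonal_commute intro: orthogonal_to_span)
  have "subspace L"
    unfolding L_eq using subspace_orthogonal_to_vectors by simp
  moreover have "dim L = ?n - i"
    using dim_subspace_orthogonal_to_vectors[of "span (u ` R)" UNIV] dimu
    by (simp add: L_eq)
  ultimately have "L \<in> grassmannian (?n - i)" by (simp add: grassmannian_def)
  moreover have "((*\<^sub>R) \<rho> ` T_simplex + L) \<inter> integer_lattice = L \<inter> integer_lattice"
  proof (intro set_eqI iffI)
    fix z assume "z \<in> L \<inter> integer_lattice"
    moreover have "0 \<in> (*\<^sub>R) \<rho> ` T_simplex"
      by (rule image_eqI[of _ _ 0]) (auto simp: T_simplex_eq)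
    ultimately show "z \<in> ((*\<^sub>R) \<rho> ` T_simplex + L) \<inter> integer_lattice"
      using set_plus_intro[of 0 _ z L] by auto
  next
    fix z assume z: "z \<in> ((*\<^sub>R) \<rho> ` T_simplex + L) \<inter> integer_lattice"
    then obtain t y where t: "t \<in> T_simplex" and y: "y \<in> L" and zty: "z = \<rho> *\<^sub>R t + y"
      by (auto elim!: set_plus_elim)
    have t1: "-1 \<le> t $ j" and t2: "(\<Sum>j\<in>UNIV. t $ j) \<le> 1" for j
      using t by (auto simp: T_simplex_eq)
    have lower: "- real (card (P k)) \<le> u k \<bullet> t" for k
      using sum_mono[of "P k" "\<lambda>_. -1" "\<lambda>j. t $ j"] t1 by (simp add: inner)
    have uz: "u k \<bullet> z = \<rho> * (u k \<bullet> t)" if "k \<in> R" for k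
      using y that by (simp add: zty inner_add_right L_def)
    have int: "u k \<bullet> z \<in> \<int>" for k
      using z by (auto simp: inner integer_lattice_def intro!: Ints_sum)
    have nonneg: "0 \<le> u k \<bullet> z" if "k \<in> R" for k
    proof -
      have "\<rho> * (u k \<bullet> t) \<ge> \<rho> * - m"
        using lower[of k] P_le[of k] \<rho>(1) by (intro mult_left_mono) linarith+
      then have "u k \<bullet> z > -1" using \<rho>m uz[OF that] by simp
      then show ?thesis using int[of k] by (auto elim!: Ints_cases)
    qed
    have part: "(\<Sum>k\<in>R. u k \<bullet> x) + u q \<bullet> x = (\<Sum>j\<in>UNIV. x $ j)" for x
    proof -
      have "(\<Sum>k\<in>R. u k \<bullet> x) + u q \<bullet> x = (\<Sum>k\<in>{..i}. u k \<bullet> x)"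
        using q by (simp add: R_def sum.remove add.commute)
      also have "\<dots> = (\<Sum>k\<in>{..i}. \<Sum>j | j \<in> UNIV \<and> \<beta> j mod (i + 1) = k. x $ j)"
        by (simp add: inner P_def)
      also have "\<dots> = (\<Sum>j\<in>UNIV. x $ j)"
        by (rule sum.group) (auto simp: less_Suc_eq_le[symmetric])
      finally show ?thesis .
    qed
    have "(\<Sum>k\<in>R. u k \<bullet> z) = \<rho> * (\<Sum>k\<in>R. u k \<bullet> t)"
      by (simp add: uz sum_distrib_left)
    \<comment> \<open>The sum over \<open>R\<close> is the full coordinate sum, at most 1, minus the
      sum over \<open>P q\<close>, at least \<open>- card (P q)\<close>; the extra index in class
      \<open>q\<close> accounts for the 1.\<close>
    also have "\<dots> \<le> \<rho> * m"
      using part[of t] t2 lower[of q] Pq_le \<rho>(1) by (intro mult_left_mono) linarith+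
    finally have total: "(\<Sum>k\<in>R. u k \<bullet> z) < 1" using \<rho>m by simp
    have "u k \<bullet> z = 0" if "k \<in> R" for k
    proof -
      have "u k \<bullet> z \<le> (\<Sum>k\<in>R. u k \<bullet> z)"
        using that nonneg by (intro member_le_sum) (auto simp: R_def)
      then show ?thesis using nonneg[OF that] total int[of k] by (auto elim!: Ints_cases)
    qed
    then show "z \<in> L \<inter> integer_lattice" using z by (auto simp: L_def)
  qed
  ultimately show thesis by (rule that)
qed

text \<open>The infimum is attained: the claimed value is admissible for every subspace, and each
  smaller positive value fails for the residue class subspace.\<close>

theorem theorem1p3:
  fixes i :: nat
  assumes "1 \<le> i" and "i \<le> CARD('n::finite)"
  shows "packing_minimum i (T_simplex :: (real ^ 'n) set) integer_lattice
           = 1 / (real_of_int \<lfloor>real CARD('n) / real (i + 1)\<rfloor> + 1)"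
proof -
  define \<rho> where "\<rho> = 1 / (real (CARD('n) div (i + 1)) + 1)"
  let ?S = "{\<rho>. \<rho> > 0 \<and> (\<forall>L \<in> grassmannian (CARD('n) - i).
    ((*\<^sub>R) \<rho> ` (T_simplex :: (real ^ 'n) set) + L) \<inter> integer_lattice \<noteq> L \<inter> integer_lattice)}"
  have "\<rho> \<in> ?S"
    using lattice_point_outside_subspace[OF _ assms \<rho>_def] by (simp add: \<rho>_def)
  moreover have "\<rho> \<le> x" if "x \<in> ?S" for x
  proof (rule ccontr)
    assume "\<not> \<rho> \<le> x"
    then show False
      using subspace_without_new_lattice_points[OF assms, of x] that by (auto simp: \<rho>_def)
  qed
  ultimately have "packing_minimum i (T_simplex :: (real ^ 'n) set) integer_lattice = \<rho>"
    unfolding packing_minimum_def by (rule cInf_eq_minimum)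
  then show ?thesis by (simp only: \<rho>_def floor_divide_of_nat_eq of_int_of_nat_eq)
qed

end
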